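(* Consider a type I model, and let $\mu$ be a probability measure on $\mathcal{X}_0$ such that $\mu^{\mathbb{Z}}(\mathcal{X}^* )=1$ and $\mathcal{T}\mu^{\mathbb{Z}}=\mu^{\mathbb{Z}}$. Suppose that for $\mathbf{P}_{\mu^{\mathbb{Z}}}$-almost every realization of $u_0=(u_0^t)_{t\in\mathbb{Z}}$ there exists at most one $x=(x^t)_{t\in\mathbb{Z}}\in\mathcal{X}_0^{\mathbb{Z}}$ such that $\check F^{(2)}(u_0^t,x^t)=x^{t+1}$ for all $t\in\mathbb{Z}$. Then $\mu^{\mathbb{Z}}$ is ergodic under $\mathcal{T}$.
   Context: Type I model: $\mathcal{X}_0,\mathcal{U}_0$ Polish spaces, $F:\mathcal{X}_0\times\mathcal{U}_0\to\mathcal{X}_0\times\mathcal{U}_0$ an involution, $F_n^t:=F$ for all $n,t\in\mathbb{Z}$. $\mathcal{X}^*$ is the set of $x=(x_n)_{n\in\mathbb{Z}}\in\mathcal{X}_0^{\mathbb{Z}}$ for which there is a unique family $(x_n^t,u_n^t)_{n,t\in\mathbb{Z}}$ with $F(x_n^t,u_{n-1}^t)=(x_n^{t+1},u_n^t)$ for all $n,t$ and $x_n^0=x_n$ for all $n$; $\mathcal{T}(x)_n:=x_n^1$. For a probability measure $P$ with $P(\mathcal{X}^* )=1$, $\mathbf{P}_P$ is the law of this family when $(x_n^0)_n\sim P$. The dual involution is $\check F:=\pi\circ F\circ\pi:\mathcal{U}_0\times\mathcal{X}_0\to\mathcal{U}_0\times\mathcal{X}_0$ with $\pi(a,b):=(b,a)$,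 and $\check F^{(2)}$ is its second coordinate. *)

theory Defs
  imports "HOL-Probability.Probability"
begin

text \<open>Type I model with involution F on X0 x U0. A space-time family is given by
  xs n t = x_n^t and us n t = u_n^t (n = space index, t = time index).\<close>

definition family_ok ::
  "('x \<times> 'u \<Rightarrow> 'x \<times> 'u) \<Rightarrow> (int \<Rightarrow> 'x) \<Rightarrow> (int \<Rightarrow> int \<Rightarrow> 'x) \<Rightarrow> (int \<Rightarrow> int \<Rightarrow> 'u) \<Rightarrow> bool"
where
  "family_ok F x xs us \<longleftrightarrow>
     (\<forall>n t. F (xs n t, us (n - 1) t) = (xs n (t + 1), us n t)) \<and> (\<forall>n. xs n 0 = x n)"

definition Xstar :: "('x \<times> 'u \<Rightarrow> 'x \<times> 'u) \<Rightarrow> (int \<Rightarrow> 'x) set" where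
  "Xstar F = {x. \<exists>!p. family_ok F x (fst p) (snd p)}"

definition fam ::
  "('x \<times> 'u \<Rightarrow> 'x \<times> 'u) \<Rightarrow> (int \<Rightarrow> 'x) \<Rightarrow> (int \<Rightarrow> int \<Rightarrow> 'x) \<times> (int \<Rightarrow> int \<Rightarrow> 'u)"
where
  "fam F x = (THE p. family_ok F x (fst p) (snd p))"

text \<open>The dynamics T: (T x)_n = x_n^1 on X*, (arbitrarily) the identity off X*.\<close>
definition Tmap :: "('x \<times> 'u \<Rightarrow> 'x \<times> 'u) \<Rightarrow> (int \<Rightarrow> 'x) \<Rightarrow> (int \<Rightarrow> 'x)" where
  "Tmap F x = (if x \<in> Xstar F then (\<lambda>n. fst (fam F x) n 1) else x)"

definition u0 :: "('x \<times> 'u \<Rightarrow> 'x \<times> 'u) \<Rightarrow> (int \<Rightarrow> 'x) \<Rightarrow> (int \<Rightarrow> 'u)" where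
  "u0 F x = (\<lambda>t. snd (fam F x) 0 t)"

definition involution :: "('a \<Rightarrow> 'a) \<Rightarrow> bool" where
  "involution F \<longleftrightarrow> (\<forall>z. F (F z) = z)"

definition dualF :: "('x \<times> 'u \<Rightarrow> 'x \<times> 'u) \<Rightarrow> ('u \<times> 'x \<Rightarrow> 'u \<times> 'x)" where
  "dualF F = prod.swap \<circ> F \<circ> prod.swap"

definition ergodic :: "'a measure \<Rightarrow> ('a \<Rightarrow> 'a) \<Rightarrow> bool" where
  "ergodic M T \<longleftrightarrow>
     (\<forall>A \<in> sets M. T -` A \<inter> space M = A \<longrightarrow> emeasure M A = 0 \<or> emeasure M A = 1)"

end

theory Submission
  imports Defs
begin

text \<open>
  The carriers at site \<open>k\<close> and times \<open>t \<ge> -S\<close> depend only on the configuration at time \<open>-S\<close> to the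
  left of \<open>k\<close>; letting \<open>S \<rightarrow> \<infinity>\<close>, the left half of the two-sided orbit determines all carriers at \<open>k\<close>,
  hence, by the uniqueness hypothesis applied site by site, the whole configuration. So every event
  \<open>B\<close> is approximated by an event about the left half at time \<open>-S\<close>, or, by stationarity, the
  pull-back of \<open>B\<close> under the \<open>S\<close>-th power of the dynamics is close to an event about the left half
  at time \<open>0\<close>. An invariant event is close to some \<open>B\<close> depending only on the right half, hence also
  close to an event independent of \<open>B\<close>, so its probability is \<open>0\<close> or \<open>1\<close>.

  Carriers enter only through deterministic implications between configurations, which inner
  regularity turns into measurable maps.
\<close>

subsection \<open>Measurable factors and approximation\<close>

text \<open>Compact subsets whose measure is within \<open>1 / (n + 1)\<close> of that of
  \<open>G\<close> exhaust it up to a null set. Compactness of the pieces is what later makes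
  inverses of injections continuous.\<close>

lemma inner_regular_sigma_compact:
  fixes Q :: "'a::{second_countable_topology, complete_space} measure"
  assumes "finite_measure Q" and sQ: "sets Q = sets borel" and G: "G \<in> sets borel"
  obtains K :: "nat \<Rightarrow> 'a set" where "\<And>n. compact (K n)" "\<And>n. K n \<subseteq> G"
    "G - (\<Union>n. K n) \<in> null_sets Q"
proof -
  interpret finite_measure Q by fact
  have reg: "emeasure Q G = (SUP K\<in>{K. K \<subseteq> G \<and> compact K}. emeasure Q K)"
    by (rule inner_regular) (use sQ G emeasure_finite in auto)
  have "\<exists>K. compact K \<and> K \<subseteq> G \<and> measure Q G - 1 / real (Suc n) < measure Q K" for n
  proof (cases "measure Q G - 1 / real (Suc n) < 0")
    case True
    then show ?thesis by (intro exI[of _ "{}"]) auto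
  next
    case False
    have "ennreal (measure Q G - 1 / real (Suc n)) < emeasure Q G"
      unfolding emeasure_eq_measure using False by (intro ennreal_lessI) (auto simp: field_simps zero_less_measure_iff)
    then obtain K where "K \<subseteq> G" "compact K" "ennreal (measure Q G - 1 / real (Suc n)) < emeasure Q K"
      unfolding reg less_SUP_iff by auto
    then show ?thesis using False
      by (intro exI[of _ K]) (auto simp: emeasure_eq_measure ennreal_less_iff)
  qed
  then obtain K where K: "\<And>n. compact (K n)" "\<And>n. K n \<subseteq> G"
    "\<And>n. measure Q G - 1 / real (Suc n) < measure Q (K n)"
    by metis
  have [measurable]: "K n \<in> sets Q" for n
    using K(1) sQ by (simp add: borel_compact)
  have GQ[measurable]: "G \<in> sets Q" using sQ G by simp
  have "measure Q (G - (\<Union>n. K n)) \<le> 1 / real (Suc n)" for n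
  proof -
    have "measure Q (G - (\<Union>n. K n)) \<le> measure Q (G - K n)"
      by (intro finite_measure_mono) auto
    also have "\<dots> = measure Q G - measure Q (K n)"
      using K(2) by (intro finite_measure_Diff) auto
    finally show ?thesis using K(3)[of n] by linarith
  qed
  moreover have "(\<lambda>n. 1 / real (Suc n)) \<longlonglongrightarrow> 0"
    using LIMSEQ_Suc[OF lim_1_over_n] by simp
  ultimately have "measure Q (G - (\<Union>n. K n)) \<le> 0"
    by (intro LIMSEQ_le_const[of "\<lambda>n. 1 / real (Suc n)"]) auto
  then have "measure Q (G - (\<Union>n. K n)) = 0"
    by (simp add: measure_le_0_iff)
  then have "G - (\<Union>n. K n) \<in> null_sets Q"
    by (intro null_setsI) (auto simp: emeasure_eq_measure)
  with K that show thesis by blast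
qed

text \<open>On a compact piece of the joint graph, the projection to the \<open>c\<close>-coordinate is a continuous
  injection, hence a homeomorphism onto its image; this avoids the Lusin--Souslin theorem.\<close>

lemma AE_eq_measurable_function_of:
  fixes f :: "'a::polish_space \<Rightarrow> 'b::polish_space" and c :: "'a \<Rightarrow> 'c::polish_space"
  assumes "finite_measure M" and sM: "sets M = sets borel"
    and f: "f \<in> borel_measurable borel" and c: "c \<in> borel_measurable borel"
    and "AE x in M. x \<in> E'"
    and det: "\<And>x x'. x \<in> E' \<Longrightarrow> x' \<in> E' \<Longrightarrow> c x = c x' \<Longrightarrow> f x = f x'"
  obtains g where "g \<in> borel_measurable borel" "AE x in M. f x = g (c x)"
proof -
  interpret finite_measure M by fact
  have spM: "space M = UNIV" using sets_eq_imp_space_eq[OF sM] by simp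
  \<comment> \<open>\<open>E'\<close> may fail to be measurable; the complement of a measurable null
    set covering \<open>- E'\<close> is a Borel set of full measure inside it.\<close>
  obtain N where N: "N \<in> null_sets M" "- E' \<subseteq> N"
    using \<open>AE x in M. x \<in> E'\<close> by (auto simp: eventually_ae_filter spM)
  define E where "E = - N"
  have E: "E \<in> sets borel" "AE x in M. x \<in> E" "E \<subseteq> E'"
    using N AE_not_in[OF N(1)] sM by (auto simp: E_def)
  note [measurable] = f c E(1)
  have [measurable_cong]: "sets M = sets borel" by fact
  define j where "j = (\<lambda>x. (f x, c x))"
  define Q where "Q = distr M borel (\<lambda>x. (x, j x))"
  have j[measurable]: "j \<in> borel_measurable borel" unfolding j_def by measurable
  have graph[measurable]: "(\<lambda>x. (x, j x)) \<in> borel_measurable M"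
    by measurable
  have "finite_measure Q" unfolding Q_def by (rule finite_measure_distr) measurable
  \<comment> \<open>Keeping the point \<open>x\<close> as a coordinate makes this set Borel, whereas
    the image of \<open>E\<close> under \<open>j\<close> need not be. The law \<open>Q\<close> is
    carried by it.\<close>
  define G where "G = {p :: 'a \<times> 'b \<times> 'c. fst p \<in> E \<and> j (fst p) = snd p}"
  have G: "G \<in> sets borel"
  proof -
    have [measurable]: "(fst :: 'a \<times> 'b \<times> 'c \<Rightarrow> 'a) \<in> borel_measurable borel"
      "(snd :: 'a \<times> 'b \<times> 'c \<Rightarrow> 'b \<times> 'c) \<in> borel_measurable borel"
      by (auto intro!: borel_measurable_continuous_onI continuous_intros)
    have "{p \<in> space borel. fst p \<in> E} \<inter> {p \<in> space borel. j (fst p) = (snd p :: 'b \<times> 'c)} \<in> sets borel"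
      by measurable
    then show ?thesis by (simp add: G_def Int_def)
  qed
  have "sets Q = sets borel" by (simp add: Q_def)
  then obtain K :: "nat \<Rightarrow> ('a \<times> 'b \<times> 'c) set" where
    K: "\<And>n. compact (K n)" "\<And>n. K n \<subseteq> G" "G - (\<Union>n. K n) \<in> null_sets Q"
    using inner_regular_sigma_compact[OF \<open>finite_measure Q\<close> _ G] by blast
  define K' where "K' n = snd ` K n" for n :: nat
  define C where "C n = snd ` K' n" for n
  have cK': "compact (K' n)" for n
    unfolding K'_def using K(1) by (intro compact_continuous_image continuous_intros)
  have cC: "compact (C n)" for n
    unfolding C_def using cK' by (intro compact_continuous_image continuous_intros)
  \<comment> \<open>The indices \<open>n\<close> and \<open>m\<close> may differ, so the local
    inverses on the pieces agree where these overlap and glue to one \<open>g\<close>.\<close>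
  have uniq: "b = b'" if K'_mem: "(b, y) \<in> K' n" "(b', y) \<in> K' m" for b b' y n m
  proof -
    obtain x x' where "(x, b, y) \<in> K n" "(x', b', y) \<in> K m"
      using K'_mem by (auto simp: K'_def)
    then have "(x, b, y) \<in> G" "(x', b', y) \<in> G"
      using K(2) by blast+
    then have "x \<in> E'" "x' \<in> E'" "c x = c x'" "f x = b" "f x' = b'"
      using E(3) by (auto simp: G_def j_def)
    then show ?thesis using det by metis
  qed
  define g where "g y = (if y \<in> (\<Union>n. C n) then SOME b. \<exists>n. (b, y) \<in> K' n else undefined)" for y
  have g: "g y = b" if "(b, y) \<in> K' n" for b y n
  proof -
    have "y \<in> (\<Union>n. C n)" using that unfolding C_def by force
    moreover have "\<exists>n. (SOME b. \<exists>n. (b, y) \<in> K' n, y) \<in> K' n"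
      using that by (intro someI[of "\<lambda>b. \<exists>n. (b, y) \<in> K' n"]) auto
    ultimately show ?thesis using that uniq by (auto simp: g_def)
  qed
  have contg: "continuous_on (C n) g" for n
  proof -
    have "continuous_on (snd ` K' n) (\<lambda>y. (g y, y))"
      by (rule continuous_on_inv) (use cK' g in \<open>auto intro!: continuous_intros\<close>)
    from continuous_on_fst[OF this] show ?thesis by (simp add: C_def)
  qed
  have [measurable]: "C n \<in> sets borel" for n using cC by (simp add: borel_compact)
  have "g \<in> borel_measurable borel"
  \<comment> \<open>The pieces \<open>C n\<close> and the complement of their union, where
    \<open>g\<close> is constant, form a countable Borel cover with \<open>g\<close> continuous on
    each member.\<close>
  proof (rule measurable_piecewise_restrict[of "insert (- (\<Union>n. C n)) (range C)"])
    fix X assume X: "X \<in> insert (- (\<Union>n. C n)) (range C)"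
    have "continuous_on (- (\<Union>n. C n)) g"
      by (rule continuous_on_eq[of _ "\<lambda>_. undefined"]) (auto simp: g_def)
    with X contg have "continuous_on X g" by auto
    then show "g \<in> borel_measurable (restrict_space borel X)"
      by (rule borel_measurable_continuous_on_restrict)
  qed auto
  moreover have "AE x in M. f x = g (c x)"
  proof -
    have "AE p in Q. p \<notin> G - (\<Union>n. K n)"
      using K(3) by (rule AE_not_in)
    then have "AE x in M. (x, j x) \<notin> G - (\<Union>n. K n)"
      unfolding Q_def by (rule AE_distrD[OF graph])
    with E(2) show ?thesis
    proof eventually_elim
      case (elim x)
      then obtain n where "(x, j x) \<in> K n" by (auto simp: G_def)
      then have "(f x, c x) \<in> K' n" by (force simp: K'_def j_def)
      then show ?case using g by simp
    qed
  qed
  ultimately show thesis by (rule that)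
qed

text \<open>Each preimage of a basis set is measurable up to a null part. The basis is countable, so
  one measurable null set covers all these parts, and making \<open>f\<close> constant there repairs
  every preimage at once.\<close>

lemma completion_ex_borel_measurable_second_countable:
  fixes f :: "'a \<Rightarrow> 'b::second_countable_topology"
  assumes f: "f \<in> borel_measurable (completion M)"
  obtains f' where "f' \<in> borel_measurable M" "AE x in M. f x = f' x"
proof -
  obtain B :: "'b set set" where B: "countable B" "topological_basis B"
    using ex_countable_basis by auto
  have sB: "(borel :: 'b measure) = sigma UNIV B"
    using B by (rule borel_eq_countable_basis)
  have fb: "f -` b \<inter> space M \<in> sets (completion M)" if "b \<in> B" for b
    using measurable_sets[OF f, of b] topological_basis_open[OF B(2) that] by auto
  define N where "N = (\<Union>b\<in>B. null_part M (f -` b \<inter> space M))"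
  have "N \<in> null_sets (completion M)"
    unfolding N_def using B(1) fb by (intro null_sets_UN') (auto intro: null_part_null_sets)
  then obtain N' where N': "N' \<in> null_sets M" "N \<subseteq> N'"
    by (auto simp: null_sets_completion_iff2)
  define f' where "f' x = (if x \<in> N' then undefined else f x)" for x
  have [measurable]: "N' \<in> sets M" using N' by auto
  have "f' \<in> borel_measurable M"
    unfolding sB
  proof (rule measurable_measure_of)
    fix b assume b: "b \<in> B"
    let ?m = "main_part M (f -` b \<inter> space M)"
    have m[measurable]: "?m \<in> sets M" using fb[OF b] by (rule main_part_sets)
    have "?m \<union> null_part M (f -` b \<inter> space M) = f -` b \<inter> space M"
      by (rule main_part_null_part_Un[OF fb[OF b]])
    moreover have "null_part M (f -` b \<inter> space M) \<subseteq> N'"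
      using b N'(2) by (auto simp: N_def)
    ultimately have "(f -` b \<inter> space M) - N' = ?m - N'" by blast
    then have "f' -` b \<inter> space M = (?m - N') \<union> (if undefined \<in> b then N' else {})"
      using sets.sets_into_space[of N' M] by (auto simp: f'_def split: if_splits)
    then show "f' -` b \<inter> space M \<in> sets M" by simp
  qed auto
  moreover have "AE x in M. f x = f' x"
    using AE_not_in[OF N'(1)] by eventually_elim (simp add: f'_def)
  ultimately show thesis by (rule that)
qed

text \<open>Induction over the generated sigma-algebra: complements leave symmetric differences
  unchanged, and a countable union is first cut to a finite one by continuity from below.\<close>

lemma (in finite_measure) algebra_approximates_sigma_sets:
  assumes alg: "algebra (space M) \<A>" and sub: "\<A> \<subseteq> sets M"
    and B: "B \<in> sigma_sets (space M) \<A>" and "e > 0"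
  shows "\<exists>D\<in>\<A>. measure M (sym_diff B D) < e"
  using B \<open>e > 0\<close>
proof (induction arbitrary: e rule: sigma_sets.induct)
  interpret \<A>: algebra "space M" \<A> by fact
  have sM: "X \<in> sets M" if "X \<in> sigma_sets (space M) \<A>" for X
    using that sub sets.sigma_sets_subset by blast
  {
    case (Basic a)
    then show ?case by (intro bexI[of _ a]) auto
  next
    case Empty
    then show ?case by (intro bexI[of _ "{}"]) auto
  next
    case (Compl a)
    then obtain D where D: "D \<in> \<A>" "measure M (sym_diff a D) < e" by blast
    have "sym_diff (space M - a) (space M - D) = sym_diff a D"
      using sets.sets_into_space[OF sM[OF Compl(1)]] sets.sets_into_space[of D M] D(1) sub by auto
    then show ?case using D by (intro bexI[of _ "space M - D"]) auto
  next
    case (Union a)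
    let ?U = "\<Union>i. a i"
    have [measurable]: "a i \<in> sets M" for i using Union(1) sM by auto
    have "(\<lambda>n. measure M (\<Union>i\<le>n. a i)) \<longlonglongrightarrow> measure M (\<Union>n. \<Union>i\<le>n. a i)"
      by (intro finite_Lim_measure_incseq) (auto simp: incseq_def intro: order_trans)
    moreover have "(\<Union>n. \<Union>i\<le>n. a i) = ?U" by auto
    ultimately have "\<forall>\<^sub>F n in sequentially. dist (measure M (\<Union>i\<le>n. a i)) (measure M ?U) < e/2"
      using tendstoD half_gt_zero[OF Union(3)] by metis
    then obtain n where n: "dist (measure M (\<Union>i\<le>n. a i)) (measure M ?U) < e/2"
      by (auto simp: eventually_sequentially)
    have tail: "measure M (?U - (\<Union>i\<le>n. a i)) < e/2"
    proof -
      have "measure M (?U - (\<Union>i\<le>n. a i)) = measure M ?U - measure M (\<Union>i\<le>n. a i)"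
        by (intro finite_measure_Diff) auto
      then show ?thesis using n unfolding dist_real_def by linarith
    qed
    \<comment> \<open>The tail has used half of \<open>e\<close>; the \<open>n + 1\<close> sets with
      index at most \<open>n\<close> share the other half.\<close>
    have "\<exists>D\<in>\<A>. measure M (sym_diff (a i) D) < e / (2 * real (Suc n))" for i
      using Union(2,3) by simp
    then obtain D where D: "\<And>i. D i \<in> \<A>" "\<And>i. measure M (sym_diff (a i) (D i)) < e / (2 * real (Suc n))"
      by metis
    have [measurable]: "D i \<in> sets M" for i using D(1) sub by auto
    have "measure M (sym_diff ?U (\<Union>i\<le>n. D i))
        \<le> measure M ((?U - (\<Union>i\<le>n. a i)) \<union> (\<Union>i\<le>n. sym_diff (a i) (D i)))"
      by (intro finite_measure_mono) auto
    also have "\<dots> \<le> measure M (?U - (\<Union>i\<le>n. a i)) + measure M (\<Union>i\<le>n. sym_diff (a i) (D i))"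
      by (intro measure_Un_le) auto
    also have "measure M (\<Union>i\<le>n. sym_diff (a i) (D i)) \<le> (\<Sum>i\<le>n. measure M (sym_diff (a i) (D i)))"
      by (intro measure_UNION_le) auto
    also have "\<dots> \<le> (\<Sum>i\<le>n. e / (2 * real (Suc n)))"
      using D(2) by (intro sum_mono less_imp_le)
    also have "\<dots> = e / 2" by (simp add: field_simps)
    finally have "measure M (sym_diff ?U (\<Union>i\<le>n. D i)) < e" using tail by linarith
    moreover have "(\<Union>i\<le>n. D i) \<in> \<A>" using D(1) by (intro \<A>.finite_UN) auto
    ultimately show ?case by blast
  }
qed

subsection \<open>Space-time families\<close>

lemma fam_ok: "x \<in> Xstar F \<Longrightarrow> family_ok F x (fst (fam F x)) (snd (fam F x))"
  unfolding fam_def Xstar_def by (rule theI') simp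

lemma fam_eqI:
  assumes "x \<in> Xstar F" "family_ok F x xs us"
  shows "fam F x = (xs, us)"
  unfolding fam_def using assms by (intro the1_equality) (auto simp: Xstar_def)

lemma fam_step:
  assumes "x \<in> Xstar F"
  shows "F (fst (fam F x) n t, snd (fam F x) (n - 1) t) = (fst (fam F x) n (t + 1), snd (fam F x) n t)"
  using fam_ok[OF assms] by (simp add: family_ok_def)

lemma fam_init: "x \<in> Xstar F \<Longrightarrow> fst (fam F x) n 0 = x n"
  using fam_ok[of x F] by (simp add: family_ok_def)

text \<open>The local rule is the same at every site, so the shifted arrays solve the equations of
  the shifted configuration, whose family is unique. This moves statements from site 0 to site
  \<open>k\<close>.\<close>

lemma fam_space_shift:
  assumes "x \<in> Xstar F" "(\<lambda>n. x (n + k)) \<in> Xstar F"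
  shows "fam F (\<lambda>n. x (n + k)) = (\<lambda>n. fst (fam F x) (n + k), \<lambda>n. snd (fam F x) (n + k))"
proof (rule fam_eqI[OF assms(2)])
  have "F (fst (fam F x) (n + k) t, snd (fam F x) (n - 1 + k) t)
      = (fst (fam F x) (n + k) (t + 1), snd (fam F x) (n + k) t)" for n t
    using fam_step[OF assms(1), of "n + k" t] by (simp add: algebra_simps)
  then show "family_ok F (\<lambda>n. x (n + k)) (\<lambda>n. fst (fam F x) (n + k)) (\<lambda>n. snd (fam F x) (n + k))"
    using assms(1) by (simp add: family_ok_def fam_init)
qed

lemma fam_time_shift:
  assumes "x \<in> Xstar F" "Tmap F x \<in> Xstar F"
  shows "fam F (Tmap F x) = (\<lambda>n t. fst (fam F x) n (t + 1), \<lambda>n t. snd (fam F x) n (t + 1))"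
  using assms by (intro fam_eqI) (auto simp: family_ok_def fam_step Tmap_def)

text \<open>Families extend to negative times: the family of \<open>Tmap F x\<close> at time -1 is
  \<open>x\<close> itself.\<close>

lemma Tmap_inj:
  assumes "x \<in> Xstar F" "Tmap F x \<in> Xstar F" "x' \<in> Xstar F" "Tmap F x' \<in> Xstar F"
    and eq: "Tmap F x = Tmap F x'"
  shows "x = x'"
proof
  fix n
  have "fst (fam F (Tmap F x)) n (-1) = fst (fam F (Tmap F x')) n (-1)" by (simp add: eq)
  then show "x n = x' n"
    using assms(1-4) by (simp add: fam_time_shift fam_init)
qed

text \<open>States of a single site from time 0 on, started in \<open>a\<close> and driven by the
  incoming carriers \<open>u\<close>. Forward evolution is explicit once the incoming carriers are
  known, hence time is a natural number here.\<close>

primrec site_orbit :: "('x \<times> 'u \<Rightarrow> 'x \<times> 'u) \<Rightarrow> (nat \<Rightarrow> 'u) \<Rightarrow> 'x \<Rightarrow> nat \<Rightarrow> 'x" where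
  "site_orbit F u a 0 = a"
| "site_orbit F u a (Suc t) = fst (F (site_orbit F u a t, u t))"

text \<open>The carriers entering the \<open>j\<close>-th site to the right of a boundary whose
  carriers are \<open>u\<close>, with \<open>a\<close> the initial states of these sites.\<close>

primrec carrier_column :: "('x \<times> 'u \<Rightarrow> 'x \<times> 'u) \<Rightarrow> (nat \<Rightarrow> 'u) \<Rightarrow> (nat \<Rightarrow> 'x) \<Rightarrow> nat \<Rightarrow> nat \<Rightarrow> 'u" where
  "carrier_column F u a 0 = u"
| "carrier_column F u a (Suc j) =
     (\<lambda>t. snd (F (site_orbit F (carrier_column F u a j) (a j) t, carrier_column F u a j t)))"

text \<open>Glue the nonnegative-time left quadrant of the family of \<open>y\<close>, extended to the right by
  evolving \<open>y'\<close> forward, with the negative-time part of the family of \<open>y'\<close>.\<close>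

lemma fam_left_determined:
  assumes y: "y \<in> Xstar F" and y': "y' \<in> Xstar F" and eq: "\<And>n. n \<le> k \<Longrightarrow> y n = y' n"
    and "n \<le> k" "0 \<le> t"
  shows "fst (fam F y) n t = fst (fam F y') n t" "snd (fam F y) n t = snd (fam F y') n t"
proof -
  define a where "a j = y' (k + 1 + int j)" for j
  define C where "C = carrier_column F (\<lambda>t. snd (fam F y) k (int t)) a"
  define xs where "xs n t = (if t < 0 then fst (fam F y') n t
      else if n \<le> k then fst (fam F y) n t
      else site_orbit F (C (nat (n - k - 1))) (a (nat (n - k - 1))) (nat t))" for n t :: int
  define us where "us n t = (if t < 0 then snd (fam F y') n t
      else if n \<le> k then snd (fam F y) n t
      else C (nat (n - k)) (nat t))" for n t :: int
  have xs0: "xs n 0 = y' n" for n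
    using eq fam_init[OF y] by (auto simp: xs_def a_def)
  have step: "F (xs n t, us (n - 1) t) = (xs n (t + 1), us n t)" for n t
  proof (cases "t < 0")
    case True
    \<comment> \<open>For \<open>t = -1\<close> the step crosses the seam between the two
      definitions; \<open>xs0\<close> makes them match at time 0.\<close>
    have "xs n (t + 1) = fst (fam F y') n (t + 1)"
    proof (cases "t = -1")
      case True
      then show ?thesis using xs0 fam_init[OF y'] by simp
    next
      case False
      with \<open>t < 0\<close> show ?thesis by (simp add: xs_def)
    qed
    with True show ?thesis using fam_step[OF y'] by (simp add: xs_def us_def)
  next
    case False
    show ?thesis
    proof (cases "n \<le> k")
      case True
      with False show ?thesis using fam_step[OF y] by (simp add: xs_def us_def)
    next
      case nk: False
      define j where "j = nat (n - k - 1)"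
      \<comment> \<open>At \<open>n = k + 1\<close> the incoming carriers are the boundary column of
        \<open>y\<close> at \<open>k\<close>, which is \<open>C 0\<close>.\<close>
      have "us (n - 1) t = C j (nat t)"
        using False nk by (cases "n = k + 1") (auto simp: us_def j_def C_def algebra_simps)
      moreover have "nat (n - k) = Suc j" "nat (t + 1) = Suc (nat t)"
        using False nk by (auto simp: j_def)
      ultimately show ?thesis
        using False nk by (simp add: xs_def us_def flip: j_def) (simp add: C_def)
    qed
  qed
  \<comment> \<open>The glued arrays start from \<open>y'\<close>, so uniqueness makes them its
    family; on the left quadrant they are the family of \<open>y\<close> by construction.\<close>
  have "fam F y' = (xs, us)"
    using step xs0 by (intro fam_eqI[OF y']) (simp add: family_ok_def)
  with assms(4,5) show "fst (fam F y) n t = fst (fam F y') n t" "snd (fam F y) n t = snd (fam F y') n t"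
    by (simp_all add: xs_def us_def)
qed

text \<open>The uniqueness hypothesis as a property of an arbitrary carrier sequence, so that it can
  be used at every site.\<close>

definition carrier_unique :: "('x \<times> 'u \<Rightarrow> 'x \<times> 'u) \<Rightarrow> (int \<Rightarrow> 'u) \<Rightarrow> bool" where
  "carrier_unique F u \<longleftrightarrow>
    (\<forall>y z. (\<forall>t. snd (dualF F (u t, y t)) = y (t + 1)) \<and>
           (\<forall>t. snd (dualF F (u t, z t)) = z (t + 1)) \<longrightarrow> y = z)"

lemma carrier_uniqueD:
  assumes "carrier_unique F u" "\<And>t. fst (F (y t, u t)) = y (t + 1)" "\<And>t. fst (F (z t, u t)) = z (t + 1)"
  shows "y = z"
  using assms by (auto simp: carrier_unique_def dualF_def)

text \<open>Induction to the right: equal carriers at \<open>m\<close> force equal states at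
  \<open>m + 1\<close> for all times by uniqueness, and \<open>F\<close> then gives equal carriers
  at \<open>m + 1\<close>. Time 0 returns the configurations.\<close>

lemma right_determined_by_carrier:
  assumes x: "x \<in> Xstar F" and x': "x' \<in> Xstar F"
    and uq: "\<And>n. carrier_unique F (snd (fam F x) n)"
    and eq: "snd (fam F x) k = snd (fam F x') k"
    and "n > k"
  shows "x n = x' n"
proof -
  have next_x: "fst (fam F x) (m + 1) = fst (fam F x') (m + 1)"
    if "snd (fam F x) m = snd (fam F x') m" for m
    using fam_step[OF x, of "m + 1"] fam_step[OF x', of "m + 1"] that
    by (intro carrier_uniqueD[OF uq[of m]]) simp_all
  have u: "snd (fam F x) (k + int j) = snd (fam F x') (k + int j)" for j
  proof (induction j)
    case (Suc j)
    have "snd (fam F x) (k + int j + 1) t = snd (fam F x') (k + int j + 1) t" for t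
      using fam_step[OF x, of "k + int j + 1" t] fam_step[OF x', of "k + int j + 1" t]
        next_x[OF Suc] Suc by simp
    then show ?case by (auto simp: algebra_simps)
  qed (simp add: eq)
  have "k + int (nat (n - k - 1)) + 1 = n" using \<open>n > k\<close> by simp
  with next_x[OF u[of "nat (n - k - 1)"]] have "fst (fam F x) n 0 = fst (fam F x') n 0"
    by simp
  then show ?thesis by (simp add: fam_init x x')
qed

subsection \<open>Invertible systems with a generating factor\<close>

text \<open>Abstract form of the dynamics: \<open>h\<close> is an almost sure inverse of
  \<open>T\<close>, and \<open>c\<close> will be the left half of a configuration. By
  \<open>c_T\<close> the factor evolves on its own; by \<open>c_generates\<close> its entire past
  determines the point. Both are pointwise implications on \<open>E\<close>, without any
  measurability in them.\<close>

locale invertible_factor = prob_space M for M :: "'w::polish_space measure" +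
  fixes T h c :: "'w \<Rightarrow> 'w" and E :: "'w set"
  assumes sets_M: "sets M = sets borel"
    and T: "T \<in> borel_measurable borel" and h: "h \<in> borel_measurable borel"
    and c: "c \<in> borel_measurable borel"
    and T_preserves: "distr M borel T = M"
    and h_T: "AE x in M. h (T x) = x"
    and AE_E: "AE x in M. x \<in> E"
    and c_T: "\<And>x x'. x \<in> E \<Longrightarrow> x' \<in> E \<Longrightarrow> c x = c x' \<Longrightarrow> c (T x) = c (T x')"
    and c_generates: "\<And>x x'. x \<in> E \<Longrightarrow> x' \<in> E \<Longrightarrow> (\<And>s. c ((h ^^ s) x) = c ((h ^^ s) x')) \<Longrightarrow> x = x'"
begin

lemma AE_T: "AE x in M. P x \<Longrightarrow> AE x in M. P (T x)"
proof -
  assume "AE x in M. P x"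
  then have "AE x in distr M borel T. P x"
    unfolding T_preserves .
  moreover have "T \<in> borel_measurable M"
    using T by (simp add: measurable_cong_sets[OF sets_M refl])
  ultimately show "AE x in M. P (T x)"
    by (rule AE_distrD[rotated])
qed

lemma AE_T_funpow: "AE x in M. P x \<Longrightarrow> AE x in M. P ((T ^^ s) x)"
proof (induction s)
  case (Suc s)
  then show ?case using AE_T[of "\<lambda>x. P ((T ^^ s) x)"] by (simp add: funpow_swap1)
qed simp

lemma h_funpow_T_funpow: "AE x in M. (h ^^ s) ((T ^^ s) x) = x"
proof (induction s)
  case (Suc s)
  from AE_T[OF this] h_T show ?case
    by eventually_elim (simp add: funpow_swap1)
qed simp

lemma measurable_funpow_borel:
  fixes f :: "'w \<Rightarrow> 'w"
  shows "f \<in> borel_measurable borel \<Longrightarrow> (f ^^ s) \<in> borel_measurable borel"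
proof (induction s)
  case (Suc s)
  then show ?case using measurable_comp[OF Suc(1)[OF Suc(2)] Suc(2)] by simp
qed (simp add: id_def)

lemma measure_T_funpow_vimage:
  assumes "X \<in> sets borel"
  shows "measure M ((T ^^ s) -` X) = measure M X"
proof -
  note [measurable] = T measurable_funpow_borel[OF T, of s]
  have [measurable_cong]: "sets M = sets borel" by (fact sets_M)
  have "distr M borel (T ^^ s) = M"
  proof (induction s)
    case 0
    then show ?case using distr_id2[OF sets_M[symmetric]] by (simp add: id_def)
  next
    case (Suc s)
    note [measurable] = measurable_funpow_borel[OF T, of s]
    have "distr M borel (T ^^ Suc s) = distr (distr M borel (T ^^ s)) borel T"
      by (subst distr_distr) auto
    then show ?case using Suc T_preserves by (simp add: comp_def)
  qed
  moreover have "measure (distr M borel (T ^^ s)) X = measure M ((T ^^ s) -` X \<inter> space M)"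
    by (rule measure_distr) (use assms in auto)
  moreover have "space M = UNIV" using sets_eq_imp_space_eq[OF sets_M] by simp
  ultimately show ?thesis by simp
qed

text \<open>Up to null sets, these are the events determined by \<open>c\<close> at some finite time
  \<open>-S\<close> of the past, written with powers of \<open>T\<close> instead of its
  inverse.\<close>

definition factor_algebra :: "'w set set" where
  "factor_algebra = {B \<in> sets borel. \<exists>S. \<exists>D \<in> sets borel. AE x in M. (T ^^ S) x \<in> B \<longleftrightarrow> c x \<in> D}"

text \<open>By \<open>c_T\<close>, \<open>c (T x)\<close> is almost surely a Borel function of
  \<open>c x\<close>, so one more power of \<open>T\<close> still gives an event about
  \<open>c\<close>. Hence any two exponents can be raised to a common one.\<close>

lemma factor_algebra_step:
  assumes "D \<in> sets borel" "AE x in M. (T ^^ S) x \<in> B \<longleftrightarrow> c x \<in> D"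
  shows "\<exists>D'\<in>sets borel. AE x in M. (T ^^ (S + n)) x \<in> B \<longleftrightarrow> c x \<in> D'"
proof (induction n)
  case 0
  then show ?case using assms by auto
next
  case (Suc n)
  then obtain D' where D': "D' \<in> sets borel" "AE x in M. (T ^^ (S + n)) x \<in> B \<longleftrightarrow> c x \<in> D'" by auto
  obtain g where g: "g \<in> borel_measurable borel" "AE x in M. c (T x) = g (c x)"
    using AE_eq_measurable_function_of[OF finite_measure_axioms sets_M measurable_compose[OF T c] c AE_E]
      c_T by metis
  have "AE x in M. (T ^^ (S + Suc n)) x \<in> B \<longleftrightarrow> c x \<in> g -` D'"
    using AE_T[OF D'(2)] g(2) by eventually_elim (simp add: funpow_swap1)
  moreover have "g -` D' \<in> sets borel" using measurable_sets[OF g(1) D'(1)] by simp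
  ultimately show ?case by blast
qed

lemma algebra_factor_algebra: "algebra UNIV factor_algebra"
  unfolding algebra_iff_Un
proof (intro conjI ballI)
  show "{} \<in> factor_algebra"
    by (auto simp: factor_algebra_def intro!: bexI[of _ "{}"])
next
  fix B assume "B \<in> factor_algebra"
  then obtain S D where *: "B \<in> sets borel" "D \<in> sets borel" "AE x in M. (T ^^ S) x \<in> B \<longleftrightarrow> c x \<in> D"
    by (auto simp: factor_algebra_def)
  from *(3) have "AE x in M. (T ^^ S) x \<in> UNIV - B \<longleftrightarrow> c x \<in> - D" by eventually_elim simp
  moreover have "- D \<in> sets borel" "UNIV - B \<in> sets borel" using * by auto
  ultimately show "UNIV - B \<in> factor_algebra" unfolding factor_algebra_def by blast
next
  fix B B' assume "B \<in> factor_algebra" "B' \<in> factor_algebra"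
  then obtain S D S' D' where *: "B \<in> sets borel" "D \<in> sets borel" "AE x in M. (T ^^ S) x \<in> B \<longleftrightarrow> c x \<in> D"
      "B' \<in> sets borel" "D' \<in> sets borel" "AE x in M. (T ^^ S') x \<in> B' \<longleftrightarrow> c x \<in> D'"
    by (auto simp: factor_algebra_def)
  obtain D1 where D1: "D1 \<in> sets borel" "AE x in M. (T ^^ (S + S')) x \<in> B \<longleftrightarrow> c x \<in> D1"
    using factor_algebra_step[OF *(2,3)] by blast
  obtain D2 where D2: "D2 \<in> sets borel" "AE x in M. (T ^^ (S + S')) x \<in> B' \<longleftrightarrow> c x \<in> D2"
    using factor_algebra_step[OF *(5,6), of S] by (auto simp: add.commute)
  from D1(2) D2(2) have "AE x in M. (T ^^ (S + S')) x \<in> B \<union> B' \<longleftrightarrow> c x \<in> D1 \<union> D2"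
    by eventually_elim simp
  moreover have "D1 \<union> D2 \<in> sets borel" "B \<union> B' \<in> sets borel" using D1 D2 * by auto
  ultimately show "B \<union> B' \<in> factor_algebra" unfolding factor_algebra_def by blast
qed simp

text \<open>The past of the factor generates all Borel events modulo null sets, so \<open>B\<close>
  is close to a member of \<open>factor_algebra\<close>. Pulling back by the matching power of
  \<open>T\<close> preserves the distance and turns that member into an event about
  \<open>c\<close>.\<close>

lemma borel_approximated_by_factor:
  assumes B: "B \<in> sets borel" and "e > 0"
  shows "\<exists>S. \<exists>D\<in>sets borel. measure M (sym_diff ((T ^^ S) -` B) (c -` D)) < e"
proof -
  have sp: "space M = UNIV" using sets_eq_imp_space_eq[OF sets_M] by simp
  have [measurable_cong]: "sets M = sets borel" by (fact sets_M)
  note [measurable] = T h c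
  have [measurable]: "(h ^^ s) \<in> borel_measurable borel" "(T ^^ s) \<in> borel_measurable borel" for s
    by (auto intro!: measurable_funpow_borel T h)
  define L where "L = (\<lambda>x s. c ((h ^^ s) x))"
  let ?N = "sigma UNIV factor_algebra"
  have "(\<lambda>x. L x s) \<in> borel_measurable ?N" for s
  proof (rule measurableI)
    fix D :: "'w set" assume D[measurable]: "D \<in> sets borel"
    \<comment> \<open>Since \<open>h ^^ s\<close> undoes \<open>T ^^ s\<close>, coordinate
      \<open>s\<close> of the past belongs to the algebra with exponent \<open>s\<close>.\<close>
    have "AE x in M. (T ^^ s) x \<in> (\<lambda>x. L x s) -` D \<longleftrightarrow> c x \<in> D"
      using h_funpow_T_funpow[of s] by eventually_elim (simp add: L_def)
    moreover have "(\<lambda>x. L x s) -` D \<in> sets borel"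
    proof -
      have "(\<lambda>x. L x s) \<in> borel_measurable borel" unfolding L_def by measurable
      from measurable_sets[OF this D] show ?thesis by simp
    qed
    ultimately have "(\<lambda>x. L x s) -` D \<in> factor_algebra" using D unfolding factor_algebra_def by blast
    then show "(\<lambda>x. L x s) -` D \<inter> space ?N \<in> sets ?N" by (simp add: sigma_sets.Basic)
  qed simp
  then have L_N: "L \<in> borel_measurable ?N" by (rule measurable_coordinatewise_then_product)
  have L: "L \<in> borel_measurable borel"
    by (rule measurable_coordinatewise_then_product) (simp add: L_def)
  have "x = x'" if "x \<in> E" "x' \<in> E" "L x = L x'" for x x'
    using that c_generates[of x x'] by (simp add: L_def fun_eq_iff)
  then obtain r where r: "r \<in> borel_measurable borel" "AE x in M. x = r (L x)"
    by (rule AE_eq_measurable_function_of[OF finite_measure_axioms sets_M measurable_ident_sets[OF refl] L AE_E])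
  \<comment> \<open>A version of \<open>B\<close>, equal to it almost surely, that lies exactly in
    the sigma-algebra generated by \<open>factor_algebra\<close>.\<close>
  define B' where "B' = (\<lambda>x. r (L x)) -` B"
  have "B' \<in> sigma_sets UNIV factor_algebra"
    using measurable_sets[OF measurable_compose[OF L_N r(1)] B] by (simp add: B'_def)
  moreover have "factor_algebra \<subseteq> sets M" by (auto simp: factor_algebra_def sets_M)
  ultimately obtain A where A: "A \<in> factor_algebra" "measure M (sym_diff B' A) < e"
    using algebra_approximates_sigma_sets[of factor_algebra B' e] algebra_factor_algebra \<open>e > 0\<close>
    by (auto simp: sp)
  then obtain S D where D: "A \<in> sets borel" "D \<in> sets borel" "AE x in M. (T ^^ S) x \<in> A \<longleftrightarrow> c x \<in> D"
    by (auto simp: factor_algebra_def)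
  note [measurable] = B D(1,2)
  have m: "(T ^^ S) -` X \<in> sets borel" "c -` X \<in> sets borel" "(\<lambda>x. r (L x)) -` X \<in> sets borel"
    if "X \<in> sets borel" for X
    using that measurable_sets[OF _ that, of "T ^^ S" borel] measurable_sets[OF c that]
      measurable_sets[OF measurable_compose[OF L r(1)] that] by auto
  have "measure M (sym_diff ((T ^^ S) -` B) (c -` D)) = measure M ((T ^^ S) -` sym_diff B' A)"
  proof (rule finite_measure_eq_AE)
    show "AE x in M. x \<in> sym_diff ((T ^^ S) -` B) (c -` D) \<longleftrightarrow> x \<in> (T ^^ S) -` sym_diff B' A"
      using AE_T_funpow[OF r(2), of S] D(3)
      by eventually_elim (auto simp: B'_def)
  qed (use B D m in \<open>auto simp: B'_def sets_M\<close>)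
  also have "\<dots> = measure M (sym_diff B' A)"
    by (rule measure_T_funpow_vimage) (use m B D in \<open>auto simp: B'_def\<close>)
  finally show ?thesis using A(2) D(2) by (intro exI[of _ S] bexI[of _ D]) simp_all
qed

end

text \<open>\<open>B \<inter> D\<close> is close to \<open>A\<close>, and its probability is the
  product of two numbers close to \<open>prob A\<close>; in the limit \<open>prob A\<close> equals
  its own square.\<close>

lemma (in prob_space) zero_or_one_if_approx_independent:
  assumes A: "A \<in> events"
    and approx: "\<And>e. e > 0 \<Longrightarrow> \<exists>B\<in>events. \<exists>D\<in>events. prob (sym_diff A B) < e \<and> prob (sym_diff A D) < e
      \<and> prob (B \<inter> D) = prob B * prob D"
  shows "prob A = 0 \<or> prob A = 1"
proof -
  have diff: "\<bar>prob X - prob Y\<bar> \<le> prob (sym_diff X Y)" if "X \<in> events" "Y \<in> events" for X Y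
  proof -
    have "prob X \<le> prob (Y \<union> sym_diff X Y)" "prob Y \<le> prob (X \<union> sym_diff X Y)"
      using that by (auto intro!: finite_measure_mono)
    moreover have "prob (Y \<union> sym_diff X Y) \<le> prob Y + prob (sym_diff X Y)"
       "prob (X \<union> sym_diff X Y) \<le> prob X + prob (sym_diff X Y)"
      using that by (auto intro!: measure_Un_le)
    ultimately show ?thesis by linarith
  qed
  have "\<bar>prob A - prob A * prob A\<bar> \<le> 0 + e" if "e > 0" for e
  proof -
    have "e / 4 > 0" using that by simp
    from approx[OF this] obtain B D where BD: "B \<in> events" "D \<in> events" "prob (sym_diff A B) < e / 4" "prob (sym_diff A D) < e / 4"
      "prob (B \<inter> D) = prob B * prob D"
      by blast
    have "prob (sym_diff A (B \<inter> D)) \<le> prob (sym_diff A B \<union> sym_diff A D)"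
      using A BD by (intro finite_measure_mono) auto
    also have "\<dots> \<le> prob (sym_diff A B) + prob (sym_diff A D)"
      using A BD by (intro measure_Un_le) auto
    finally have "\<bar>prob A - prob B * prob D\<bar> \<le> e / 2"
      using diff[of A "B \<inter> D"] A BD by auto
    moreover have "\<bar>prob A * prob A - prob B * prob D\<bar> \<le> e / 2"
    proof -
      have "prob A * prob A - prob B * prob D = prob A * (prob A - prob D) + (prob A - prob B) * prob D"
        by (simp add: algebra_simps)
      also have "\<bar>\<dots>\<bar> \<le> \<bar>prob A * (prob A - prob D)\<bar> + \<bar>(prob A - prob B) * prob D\<bar>"
        by (rule abs_triangle_ineq)
      also have "\<dots> \<le> \<bar>prob A - prob D\<bar> + \<bar>prob A - prob B\<bar>"
        unfolding abs_mult by (intro add_mono mult_left_le_one_le mult_right_le_one_le) auto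
      finally show ?thesis using diff[OF A BD(1)] diff[OF A BD(2)] BD(3,4) by linarith
    qed
    ultimately show ?thesis by linarith
  qed
  then have "\<bar>prob A - prob A * prob A\<bar> \<le> 0" by (rule field_le_epsilon)
  then have "prob A * (1 - prob A) = 0" by (simp add: algebra_simps)
  then show ?thesis by simp
qed

subsection \<open>Ergodicity\<close>

text \<open>Clamping the index by \<open>min\<close> or \<open>max\<close> encodes a
  half-configuration as a full one. The two clamped configurations are functions of the restrictions
  to disjoint sets of sites, which are independent under the product measure.\<close>

lemma indep_PiM_left_right:
  fixes \<mu> :: "'x::polish_space measure" and k :: int
  defines "P \<equiv> PiM UNIV (\<lambda>_::int. \<mu>)"
  assumes "prob_space \<mu>" and A: "A \<in> sets P" and B: "B \<in> sets P"
  shows "measure P ({x\<in>space P. (\<lambda>n. x (min n k)) \<in> A} \<inter> {x\<in>space P. (\<lambda>n. x (max n (k + 1))) \<in> B})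
    = measure P {x\<in>space P. (\<lambda>n. x (min n k)) \<in> A} * measure P {x\<in>space P. (\<lambda>n. x (max n (k + 1))) \<in> B}"
proof -
  interpret \<mu>: prob_space \<mu> by fact
  interpret P: prob_space P unfolding P_def by (rule prob_space_PiM) (rule \<mu>.prob_space_axioms)
  have coordinates: "P.indep_vars (\<lambda>_. \<mu>) (\<lambda>i x. x i) UNIV"
  proof (subst P.indep_vars_iff_distr_eq_PiM)
    have "distr P (PiM UNIV (\<lambda>_. \<mu>)) (\<lambda>x. \<lambda>i\<in>UNIV. x i) = P"
      using distr_id2[of P P] by (simp add: P_def id_def restrict_UNIV)
    also have "P = PiM UNIV (\<lambda>i. distr P \<mu> (\<lambda>x. x i))"
    proof -
      have "distr P \<mu> (\<lambda>x. x i) = \<mu>" for i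
        unfolding P_def by (rule distr_PiM_component) (use \<mu>.prob_space_axioms in auto)
      then show ?thesis by (subst P_def) simp
    qed
    finally show "distr P (PiM UNIV (\<lambda>_. \<mu>)) (\<lambda>x. \<lambda>i\<in>UNIV. x i) = PiM UNIV (\<lambda>i. distr P \<mu> (\<lambda>x. x i))" .
  qed (auto simp: P_def)
  have reindex: "(\<lambda>y n. y (f n)) \<in> measurable (PiM I (\<lambda>_. \<mu>)) P"
    if f: "\<And>n. f n \<in> I" for f :: "int \<Rightarrow> int" and I
    unfolding P_def
    by (rule measurable_PiM_single')
      (use f in \<open>auto simp: space_PiM intro!: measurable_component_singleton\<close>)
  from coordinates have "P.indep_var (PiM {..k} (\<lambda>_. \<mu>)) (\<lambda>x. restrict (\<lambda>i. x i) {..k})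
      (PiM {k+1..} (\<lambda>_. \<mu>)) (\<lambda>x. restrict (\<lambda>i. x i) {k+1..})"
    by (rule P.indep_var_restrict) auto
  then have "P.indep_var P ((\<lambda>y n. y (min n k)) \<circ> (\<lambda>x. restrict (\<lambda>i. x i) {..k}))
      P ((\<lambda>y n. y (max n (k+1))) \<circ> (\<lambda>x. restrict (\<lambda>i. x i) {k+1..}))"
    by (rule P.indep_var_compose) (rule reindex, simp)+
  moreover have "(\<lambda>y n. y (min n k)) \<circ> (\<lambda>x. restrict (\<lambda>i. x i) {..k}) = (\<lambda>x n. x (min n k) :: 'x)"
    "(\<lambda>y n. y (max n (k+1))) \<circ> (\<lambda>x. restrict (\<lambda>i. x i) {k+1..}) = (\<lambda>x n. x (max n (k+1)) :: 'x)"
    by (simp_all add: fun_eq_iff)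
  ultimately have iv: "P.indep_var P (\<lambda>x n. x (min n k)) P (\<lambda>x n. x (max n (k+1)))"
    by simp
  show ?thesis
    using P.indep_varD[OF iv A B] by (simp add: vimage_def Int_def conj_ac)
qed

text \<open>Events depending only on the sites from some \<open>k\<close> on form an algebra, and it
  contains all events about a single site, which generate the Borel sets.\<close>

lemma approx_right_determined:
  fixes M :: "(int \<Rightarrow> 'x::polish_space) measure"
  assumes "finite_measure M" and sM: "sets M = sets borel" and A: "A \<in> sets borel" and "e > 0"
  shows "\<exists>k. \<exists>D\<in>sets borel. measure M (sym_diff A ((\<lambda>x n. x (max n k)) -` D)) < e"
proof -
  interpret finite_measure M by fact
  have sp: "space M = UNIV" using sets_eq_imp_space_eq[OF sM] by simp
  define r where "r = (\<lambda>(k::int) (x::int \<Rightarrow> 'x) n. x (max n k))"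
  have rr: "r l (r k x) = r l x" if "k \<le> l" for k l x
    using that by (auto simp: r_def)
  have r[measurable]: "r k \<in> borel_measurable borel" for k
    unfolding r_def by (intro measurable_coordinatewise_then_product) (simp add: measurable_product_coordinates)
  have r_sets: "r k -` D \<in> sets borel" if "D \<in> sets borel" for k D
    using measurable_sets[OF r that] by simp
  define \<A> where "\<A> = {r k -` D | k D. D \<in> sets borel}"
  have alg: "algebra UNIV \<A>"
    unfolding algebra_iff_Un
  proof (intro conjI ballI)
    show "{} \<in> \<A>" by (auto simp: \<A>_def intro!: exI[of _ "{}"])
  next
    fix B assume "B \<in> \<A>"
    then obtain k D where "B = r k -` D" "D \<in> sets borel" by (auto simp: \<A>_def)
    then have "UNIV - B = r k -` (- D)" "- D \<in> sets borel" by auto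
    then show "UNIV - B \<in> \<A>" unfolding \<A>_def by blast
  next
    fix B B' assume "B \<in> \<A>" "B' \<in> \<A>"
    then obtain k D k' D' where B: "B = r k -` D" "D \<in> sets borel" "B' = r k' -` D'" "D' \<in> sets borel"
      by (auto simp: \<A>_def)
    \<comment> \<open>The smaller threshold keeps more sites, so by \<open>rr\<close> both events
      can be read off after clamping at \<open>?m\<close>.\<close>
    let ?m = "min k k'"
    have "B \<union> B' = r ?m -` (r k -` D \<union> r k' -` D')"
      by (auto simp: B rr)
    moreover have "r k -` D \<union> r k' -` D' \<in> sets borel" using r_sets B by auto
    ultimately show "B \<union> B' \<in> \<A>" unfolding \<A>_def by blast
  qed simp
  let ?N = "sigma UNIV \<A>"
  have "(\<lambda>x. x) \<in> borel_measurable ?N"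
  proof (rule measurable_coordinatewise_then_product)
    fix k show "(\<lambda>x. x k) \<in> borel_measurable ?N"
    proof (rule measurableI)
      fix X :: "'x set" assume X: "X \<in> sets borel"
      have "(\<lambda>x. x k) -` X = r k -` ((\<lambda>x. x k) -` X)" by (auto simp: r_def)
      moreover have "(\<lambda>x::int \<Rightarrow> 'x. x k) -` X \<in> sets borel"
        using measurable_sets[OF measurable_product_coordinates X, of k] by simp
      ultimately have "(\<lambda>x. x k) -` X \<in> \<A>" unfolding \<A>_def by blast
      then show "(\<lambda>x. x k) -` X \<inter> space ?N \<in> sets ?N" by (simp add: sigma_sets.Basic)
    qed simp
  qed
  from measurable_sets[OF this A] have "A \<in> sigma_sets UNIV \<A>" by simp
  moreover have "\<A> \<subseteq> sets M" using r_sets by (auto simp: \<A>_def sM)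
  ultimately obtain B where "B \<in> \<A>" "measure M (sym_diff A B) < e"
    using algebra_approximates_sigma_sets[of \<A> A e] alg \<open>e > 0\<close> by (auto simp: sp)
  then show ?thesis by (auto simp: \<A>_def r_def)
qed

lemma distr_PiM_shift:
  assumes "prob_space \<mu>"
  shows "distr (PiM UNIV (\<lambda>_::int. \<mu>)) (PiM UNIV (\<lambda>_. \<mu>)) (\<lambda>x n. x (n + k)) = PiM UNIV (\<lambda>_. \<mu>)"
  using distr_PiM_reindex[of UNIV "\<lambda>_. \<mu>" "\<lambda>n. n + k" UNIV] assms
  by (simp add: restrict_UNIV inj_on_def)

text \<open>\<open>X s\<close> plays the configuration at time \<open>-s\<close>. To compare
  carriers at a negative time \<open>t\<close>, restart the family \<open>-t\<close> steps earlier;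
  the time in question becomes nonnegative and \<open>fam_left_determined\<close> applies.\<close>

lemma left_carrier_eq:
  assumes x: "\<And>s. X s \<in> Xstar F" "\<And>s. Tmap F (X (Suc s)) = X s"
    and x': "\<And>s. X' s \<in> Xstar F" "\<And>s. Tmap F (X' (Suc s)) = X' s"
    and eq: "\<And>s n. n \<le> k \<Longrightarrow> X s n = X' s n"
  shows "snd (fam F (X 0)) k = snd (fam F (X' 0)) k"
proof
  fix t
  have rewind: "snd (fam F (Y 0)) k t = snd (fam F (Y s)) k (t + int s)"
    if "\<And>s. Y s \<in> Xstar F" "\<And>s. Tmap F (Y (Suc s)) = Y s" for Y s
  proof (induction s)
    case (Suc s)
    have "fam F (Y s) = (\<lambda>n t. fst (fam F (Y (Suc s))) n (t + 1), \<lambda>n t. snd (fam F (Y (Suc s))) n (t + 1))"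
      using fam_time_shift[of "Y (Suc s)" F] that by simp
    with Suc show ?case by (simp add: algebra_simps)
  qed simp
  let ?s = "nat (- t)"
  have "snd (fam F (X ?s)) k (t + int ?s) = snd (fam F (X' ?s)) k (t + int ?s)"
    by (rule fam_left_determined(2)[OF x(1) x'(1) eq]) auto
  then show "snd (fam F (X 0)) k t = snd (fam F (X' 0)) k t"
    using rewind[of X, OF x, of ?s] rewind[of X', OF x', of ?s] by simp
qed

theorem theorem2p11:
  fixes F :: "'x::polish_space \<times> 'u::polish_space \<Rightarrow> 'x \<times> 'u"
    and \<mu> :: "'x measure"
  assumes invol: "involution F"
    and sets_mu: "sets \<mu> = sets borel"
    and prob: "prob_space \<mu>"
    and full: "AE x in PiM (UNIV :: int set) (\<lambda>_. \<mu>). x \<in> Xstar F"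
    and T_meas: "Tmap F \<in> measurable (completion (PiM (UNIV :: int set) (\<lambda>_. \<mu>)))
                                     (PiM (UNIV :: int set) (\<lambda>_. \<mu>))"
    and T_inv: "distr (completion (PiM (UNIV :: int set) (\<lambda>_. \<mu>)))
                      (PiM (UNIV :: int set) (\<lambda>_. \<mu>)) (Tmap F)
                = PiM (UNIV :: int set) (\<lambda>_. \<mu>)"
    and uniq: "AE x in PiM (UNIV :: int set) (\<lambda>_. \<mu>).
                 \<forall>y z :: int \<Rightarrow> 'x.
                   (\<forall>t. snd (dualF F (u0 F x t, y t)) = y (t + 1)) \<and>
                   (\<forall>t. snd (dualF F (u0 F x t, z t)) = z (t + 1)) \<longrightarrow> y = z"
  shows "ergodic (PiM (UNIV :: int set) (\<lambda>_. \<mu>)) (Tmap F)"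
proof -

  \<comment> \<open>A Borel version of the dynamics\<close>
  define M where "M = PiM (UNIV :: int set) (\<lambda>_. \<mu>)"
  interpret prob_space M unfolding M_def by (rule prob_space_PiM) (rule prob)
  have sM[measurable_cong]: "sets M = sets borel"
    unfolding M_def using sets_PiM_cong[OF refl sets_mu, of UNIV] sets_PiM_equal_borel by metis
  have sp: "space M = UNIV" using sets_eq_imp_space_eq[OF sM] by simp
  have T_borel: "Tmap F \<in> borel_measurable (completion M)"
    using T_meas measurable_cong_sets[OF refl sM] unfolding M_def by blast
  have distr_T: "distr (completion M) borel (Tmap F) = M"
  proof -
    have "distr (completion M) borel (Tmap F) = distr (completion M) M (Tmap F)"
      by (rule distr_cong) (auto simp: sM)
    then show ?thesis using T_inv by (simp add: M_def)
  qed
  \<comment> \<open>\<open>Tmap F\<close> is measurable only for the completion; from here on the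
    Borel map \<open>T\<close> replaces it almost everywhere.\<close>
  obtain T where T[measurable]: "T \<in> borel_measurable M" and AE_T_eq: "AE x in M. Tmap F x = T x"
    using completion_ex_borel_measurable_second_countable[OF T_borel] by blast
  have T': "T \<in> borel_measurable borel" using T measurable_cong_sets[OF sM refl] by blast
  have T_preserves: "distr M borel T = M"
  proof -
    have "distr M borel T = distr (completion M) borel T" by (rule distr_completion[symmetric]) (rule T)
    also have "\<dots> = distr (completion M) borel (Tmap F)"
      by (rule distr_cong_AE)
        (use AE_T_eq T_borel T in \<open>auto simp: AE_completion_iff eq_commute intro: measurable_completion\<close>)
    finally show ?thesis using distr_T by simp
  qed
  have pull: "AE x in M. P (f x)" if "AE x in M. P x" "f \<in> borel_measurable M" "distr M borel f = M"
    for P :: "(int \<Rightarrow> 'x) \<Rightarrow> bool" and f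
  proof -
    have "AE x in distr M borel f. P x" unfolding that(3) by (rule that(1))
    then show ?thesis by (rule AE_distrD[OF that(2)])
  qed

  \<comment> \<open>Uniqueness at every site\<close>
  have carrier: "AE x in M. \<forall>k. carrier_unique F (snd (fam F x) k)"
    unfolding AE_all_countable
  proof
    fix k :: int
    define \<theta> where "\<theta> = (\<lambda>(x::int \<Rightarrow> 'x) n. x (n + k))"
    have \<theta>: "\<theta> \<in> borel_measurable M"
      unfolding \<theta>_def
      by (intro measurable_coordinatewise_then_product)
        (simp add: measurable_cong_sets[OF sM refl] measurable_product_coordinates)
    have "distr M borel \<theta> = distr M M \<theta>" by (rule distr_cong) (auto simp: sM)
    then have \<theta>_pres: "distr M borel \<theta> = M"
      using distr_PiM_shift[OF prob, of k] by (simp add: M_def \<theta>_def)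
    have "AE x in M. x \<in> Xstar F" "AE x in M. carrier_unique F (u0 F x)"
      unfolding M_def carrier_unique_def by (fact full uniq)+
    \<comment> \<open>The hypothesis speaks of site 0; the product measure is invariant under the
      shift by \<open>k\<close>, which carries it to site \<open>k\<close>.\<close>
    note this(1) pull[OF this(1) \<theta> \<theta>_pres] pull[OF this(2) \<theta> \<theta>_pres]
    then show "AE x in M. carrier_unique F (snd (fam F x) k)"
      by eventually_elim (simp add: \<theta>_def u0_def fam_space_shift)
  qed

  \<comment> \<open>An almost sure Borel inverse\<close>
  define G where "G = {x \<in> Xstar F. Tmap F x = T x \<and> T x \<in> Xstar F \<and> (\<forall>k. carrier_unique F (snd (fam F x) k))}"
  have AE_X: "AE x in M. x \<in> Xstar F" unfolding M_def by (fact full)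
  have AE_G: "AE x in M. x \<in> G"
    using AE_X pull[OF AE_X T T_preserves] carrier AE_T_eq
    by eventually_elim (simp add: G_def)
  have G_inj: "x = x'" if "x \<in> G" "x' \<in> G" "T x = T x'" for x x'
    using that Tmap_inj[of x F x'] by (simp add: G_def)
  \<comment> \<open>Factorization of the identity through \<open>T\<close>, which is injective on
    \<open>G\<close>.\<close>
  then obtain h where h: "h \<in> borel_measurable borel" "AE x in M. x = h (T x)"
    by (rule AE_eq_measurable_function_of[OF finite_measure_axioms sM measurable_ident_sets[OF refl] T' AE_G])
  have h_M[measurable]: "h \<in> borel_measurable M" using h(1) measurable_cong_sets[OF sM refl] by blast
  have h_preserves: "distr M borel h = M"
  proof -
    have "distr M borel h = distr (distr M borel T) borel h" by (simp add: T_preserves)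
    also have "\<dots> = distr M borel (h \<circ> T)" by (rule distr_distr) (use h T in auto)
    also have "\<dots> = distr M borel (\<lambda>x. x)"
      using h T by (intro distr_cong_AE) (auto simp: eq_commute intro: measurable_ident_sets[OF sM])
    also have "\<dots> = M" using distr_id2[OF sM[symmetric]] by (simp add: id_def)
    finally show ?thesis .
  qed
  \<comment> \<open>From \<open>h (T x) = x\<close> the identity holds at \<open>T x\<close> for
    almost every \<open>x\<close>, and \<open>T x\<close> has law \<open>M\<close>.\<close>
  have T_h: "AE x in M. T (h x) = x"
  proof -
    have "AE x in M. T (h (T x)) = T x" using h(2) by eventually_elim simp
    moreover have "{x \<in> space borel. T (h x) = x} \<in> sets borel"
      using measurable_equality_set[OF measurable_compose[OF h(1) T'], of "\<lambda>x. x"] by simp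
    ultimately have "AE x in distr M borel T. T (h x) = x"
      using T by (subst AE_distr_iff) auto
    then show ?thesis unfolding T_preserves .
  qed
  have h_iter: "AE x in M. P ((h ^^ s) x)" if "AE x in M. P x" for P s
  proof (induction s)
    case (Suc s)
    then show ?case using pull[OF Suc h_M h_preserves] by (simp add: funpow_swap1)
  qed (simp add: that)

  \<comment> \<open>The left half as a generating factor\<close>
  define E where "E = {x. \<forall>s. (h ^^ s) x \<in> G \<and> T ((h ^^ Suc s) x) = (h ^^ s) x}"
  have AE_E: "AE x in M. x \<in> E"
    unfolding E_def using h_iter[OF AE_G] h_iter[OF T_h] by (simp add: AE_all_countable)
  have E_G: "x \<in> G" if "x \<in> E" for x
    using that unfolding E_def by (auto dest: spec[of _ 0])
  define c where "c = (\<lambda>k (x::int \<Rightarrow> 'x) n. x (min n k))"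
  have c: "c k \<in> borel_measurable borel" for k
    unfolding c_def by (intro measurable_coordinatewise_then_product) (simp add: measurable_product_coordinates)
  have c_eq_iff: "c k x = c k x' \<longleftrightarrow> (\<forall>n\<le>k. x n = x' n)" for k x x'
    unfolding c_def fun_eq_iff by (metis min.absorb1 min.cobounded2)
  have factor: "invertible_factor M T h (c k) E" for k
  proof unfold_locales
    show "AE x in M. h (T x) = x" using h(2) by (simp add: eq_commute)
    show "c k (T x) = c k (T x')" if "x \<in> E" "x' \<in> E" "c k x = c k x'" for x x'
    proof -
      have g: "x \<in> G" "x' \<in> G" using that E_G by auto
      have "fst (fam F x) n 1 = fst (fam F x') n 1" if "n \<le> k" for n
        using that g \<open>c k x = c k x'\<close> by (intro fam_left_determined(1)) (auto simp: G_def c_eq_iff)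
      moreover have "T y n = fst (fam F y) n 1" if "y \<in> G" for y n
      proof -
        have "y \<in> Xstar F" "T y = Tmap F y" using that by (simp_all add: G_def)
        then show ?thesis by (simp add: Tmap_def)
      qed
      ultimately show ?thesis using g by (simp add: c_eq_iff)
    qed
    show "x = x'" if "x \<in> E" "x' \<in> E" "\<And>s. c k ((h ^^ s) x) = c k ((h ^^ s) x')" for x x'
    proof -
      have it: "(h ^^ s) y \<in> Xstar F" "Tmap F ((h ^^ Suc s) y) = (h ^^ s) y" if "y \<in> E" for y s
      proof -
        have "(h ^^ s) y \<in> G" "(h ^^ Suc s) y \<in> G" "T ((h ^^ Suc s) y) = (h ^^ s) y"
          using that unfolding E_def by blast+
        then show "(h ^^ s) y \<in> Xstar F" "Tmap F ((h ^^ Suc s) y) = (h ^^ s) y"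
          unfolding G_def by auto
      qed
      \<comment> \<open>Along the backward orbits \<open>T\<close> acts as \<open>Tmap F\<close>, so
        equal left halves at all past times give equal carriers at \<open>k\<close>; uniqueness then
        recovers the right half.\<close>
      have "snd (fam F ((h ^^ 0) x)) k = snd (fam F ((h ^^ 0) x')) k"
        by (rule left_carrier_eq[where X = "\<lambda>s. (h ^^ s) x" and X' = "\<lambda>s. (h ^^ s) x'"])
          (use it that in \<open>auto simp: c_eq_iff simp del: funpow.simps\<close>)
      then have u: "snd (fam F x) k = snd (fam F x') k" by simp
      have right: "x n = x' n" if "n > k" for n
        using right_determined_by_carrier[OF _ _ _ u that] E_G[OF \<open>x \<in> E\<close>] E_G[OF \<open>x' \<in> E\<close>]
        by (simp add: G_def)
      moreover have "x n = x' n" if "n \<le> k" for n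
        using that \<open>\<And>s. c k ((h ^^ s) x) = c k ((h ^^ s) x')\<close>[of 0] by (simp add: c_eq_iff)
      ultimately show ?thesis by (metis ext linorder_not_le)
    qed
  qed (fact sM T' h(1) c T_preserves AE_E)+

  \<comment> \<open>Zero-one law for invariant events\<close>
  show ?thesis
    unfolding ergodic_def M_def[symmetric]
  proof (intro ballI impI)
    fix A assume A[measurable]: "A \<in> sets M" and inv: "Tmap F -` A \<inter> space M = A"
    have Tmap_A: "Tmap F x \<in> A \<longleftrightarrow> x \<in> A" for x
      using inv by (metis Int_UNIV_right sp vimage_eq)
    from AE_T_eq have T_A: "AE x in M. T x \<in> A \<longleftrightarrow> x \<in> A"
    proof eventually_elim
      case (elim x)
      then show ?case using Tmap_A[of x] by simp
    qed
    have "prob A = 0 \<or> prob A = 1"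
    proof (rule zero_or_one_if_approx_independent[OF A])
      fix e :: real assume "e > 0"
      then have e2: "e / 2 > 0" by simp
      obtain k R where R: "R \<in> sets borel" "prob (sym_diff A ((\<lambda>x n. x (max n k)) -` R)) < e / 2"
        using approx_right_determined[OF finite_measure_axioms sM _ e2, of A] A sM by auto
      define B where "B = (\<lambda>(x :: int \<Rightarrow> 'x) n. x (max n k)) -` R"
      have B: "B \<in> sets borel"
      proof -
        have "(\<lambda>(x :: int \<Rightarrow> 'x) n. x (max n k)) \<in> borel_measurable borel"
          by (intro measurable_coordinatewise_then_product) (simp add: measurable_product_coordinates)
        from measurable_sets[OF this R(1)] show ?thesis by (simp add: B_def)
      qed
      \<comment> \<open>\<open>B\<close> looks at sites from \<open>k\<close> on, so the left half
        must end at \<open>k - 1\<close> for the two to be independent.\<close>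
      interpret f: invertible_factor M T h "c (k - 1)" E by (rule factor)
      obtain S L where L: "L \<in> sets borel" "prob (sym_diff ((T ^^ S) -` B) (c (k - 1) -` L)) < e / 2"
        using f.borel_approximated_by_factor[OF B e2] by blast
      define D where "D = c (k - 1) -` L"
      have D: "D \<in> sets borel" using measurable_sets[OF c L(1)] by (simp add: D_def)
      have TS: "(T ^^ S) \<in> borel_measurable borel" by (rule f.measurable_funpow_borel[OF T'])
      have TSB: "(T ^^ S) -` X \<in> events" if "X \<in> sets borel" for X
        using measurable_sets[OF TS that] by (simp add: sM)
      have T_S_A: "AE x in M. (T ^^ s) x \<in> A \<longleftrightarrow> x \<in> A" for s
      proof (induction s)
        case (Suc s)
        from f.AE_T[OF this] T_A show ?case by eventually_elim (simp add: funpow_swap1)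
      qed simp
      \<comment> \<open>Invariance of \<open>A\<close> lets the power of \<open>T\<close> be pulled
        through the symmetric difference, so \<open>B\<close> and its pull-back are equally close to
        \<open>A\<close>.\<close>
      have "prob (sym_diff A ((T ^^ S) -` B)) = prob ((T ^^ S) -` sym_diff A B)"
        by (rule finite_measure_eq_AE)
          (use T_S_A[of S] TSB A B in \<open>auto simp: sM elim!: eventually_mono\<close>)
      also have "\<dots> = prob (sym_diff A B)"
        using f.measure_T_funpow_vimage[of "sym_diff A B" S] A B by (auto simp: sM)
      finally have "prob (sym_diff A ((T ^^ S) -` B)) < e / 2" using R(2) by (simp add: B_def)
      moreover have "prob (sym_diff A D)
          \<le> prob (sym_diff A ((T ^^ S) -` B) \<union> sym_diff ((T ^^ S) -` B) D)"
        using A D TSB[OF B] by (intro finite_measure_mono) (auto simp: sM)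
      moreover have "\<dots> \<le> prob (sym_diff A ((T ^^ S) -` B)) + prob (sym_diff ((T ^^ S) -` B) D)"
        using A D TSB[OF B] by (intro measure_Un_le) (auto simp: sM)
      ultimately have "prob (sym_diff A D) < e" using L(2) by (simp add: D_def)
      moreover have "prob (sym_diff A B) < e" using R(2) \<open>e > 0\<close> by (simp add: B_def)
      moreover have "prob (B \<inter> D) = prob B * prob D"
        using indep_PiM_left_right[OF prob, of L R "k - 1"] L(1) R(1) sM
        by (simp add: M_def[symmetric] sp B_def D_def c_def vimage_def Int_commute mult.commute)
      ultimately show "\<exists>B\<in>events. \<exists>D\<in>events. prob (sym_diff A B) < e \<and> prob (sym_diff A D) < e
          \<and> prob (B \<inter> D) = prob B * prob D"
        using B D sM by blast
    qed
    then show "emeasure M A = 0 \<or> emeasure M A = 1"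
      by (auto simp: emeasure_eq_measure)
  qed
qed

end
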